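(* Let $G_n^{0,q}$ be a $(0,q)$-perturbed noisy random geometric graph in the standard setting described in the context, and suppose that $\sigma nr^d/\log n\to t\in(0,\infty)$. Then there exists a constant $C$ depending on the Besicovitch constant $\beta$ such that if $q\le C$, then there is a constant $C'$ such that with high probability every long-edge $(u,v)$ of $G_n^{0,q}$ satisfies $\omega_{u,v}(G_n^{0,q})\le C' nr^d$.
   Context: Standard setting: fix an integer $d\ge 1$ and an arbitrary norm $\|\cdot\|$ on $\mathbb{R}^d$. Let $\nu$ be a probability distribution on $\mathbb{R}^d$ with a bounded density $f$, and let $\sigma$ be the essential supremum of $f$. Let $X_1,X_2,\dots$ be i.i.d. with law $\nu$, and let $r=r(n)>0$ with $r(n)\to 0$. $G_n$ is the random geometric graph on $\{X_1,\dots,X_n\}$ in which distinct $X_i,X_j$ are adjacent iff $\|X_i-X_j\|\le r(n)$. $G_n^{0,q}$ is obtained from $G_n$ by inserting each non-edge of $G_n$ independently with probability $q=q(n)$. A long-edge of $G_n^{0,q}$ is an edge $(u,v)$ with $\|u-v\|>3r$. The edge clique number $\omega_{u,v}(G)$ is the largest size of a clique in $G$ containing both $u$ and $v$. "With high probability" means with probability tending to $1$. Besicovitch constant: a $\delta$-packing with respect to $P\subseteq\mathbb{R}^d$ is a countable collection of pairwise disjoint closed balls of radius $\delta$ centered at points of $P$; $\beta=\beta(d)\in\mathbb{N}$ is a constant such that for every $P\subseteq\mathbb{R}^d$ and $\delta>0$ there are $\beta$ $\delta$-packings with respect to $P$ whose union covers $P$. *)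

theory Defs
  imports "HOL-Probability.Probability" "HOL-Library.Ramsey"
begin

definition is_norm :: "(real ^ 'd \<Rightarrow> real) \<Rightarrow> bool" where
  "is_norm N \<longleftrightarrow>
     (\<forall>x. 0 \<le> N x) \<and>
     (\<forall>x. N x = 0 \<longleftrightarrow> x = 0) \<and>
     (\<forall>a x. N (a *\<^sub>R x) = \<bar>a\<bar> * N x) \<and>
     (\<forall>x y. N (x + y) \<le> N x + N y)"

definition norm_cball :: "(real ^ 'd \<Rightarrow> real) \<Rightarrow> real ^ 'd \<Rightarrow> real \<Rightarrow> (real ^ 'd) set" where
  "norm_cball N c \<delta> = {x. N (x - c) \<le> \<delta>}"

definition packing ::
    "(real ^ 'd \<Rightarrow> real) \<Rightarrow> real \<Rightarrow> (real ^ 'd) set \<Rightarrow> (real ^ 'd) set set \<Rightarrow> bool" where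
  "packing N \<delta> P \<B> \<longleftrightarrow>
     countable \<B> \<and> disjoint \<B> \<and> \<B> \<subseteq> (\<lambda>c. norm_cball N c \<delta>) ` P"

definition besicovitch_constant :: "(real ^ 'd \<Rightarrow> real) \<Rightarrow> nat \<Rightarrow> bool" where
  "besicovitch_constant N \<beta> \<longleftrightarrow>
     (\<forall>P \<delta>. 0 < \<delta> \<longrightarrow>
        (\<exists>\<B> :: nat \<Rightarrow> (real ^ 'd) set set.
           (\<forall>i<\<beta>. packing N \<delta> P (\<B> i)) \<and> P \<subseteq> (\<Union>i<\<beta>. \<Union>(\<B> i))))"

definition ess_sup :: "(real ^ 'd \<Rightarrow> real) \<Rightarrow> real" where
  "ess_sup f = real_of_ereal (esssup lborel (\<lambda>x. ereal (f x)))"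

text \<open>A graph on a vertex set \<open>V\<close> is given by its edge set, a subset of \<open>[V]\<^bsup>2\<^esup>\<close>. The vertices of the
  geometric graph are the indices \<open>i \<in> V\<close> of the points \<open>x i\<close>. Almost surely this makes no
  difference, since i.i.d. points with a density are pairwise distinct.\<close>

definition rgg_edges ::
    "(real ^ 'd \<Rightarrow> real) \<Rightarrow> real \<Rightarrow> (nat \<Rightarrow> real ^ 'd) \<Rightarrow> nat set \<Rightarrow> nat set set" where
  "rgg_edges N r x V = {{i, j} | i j. i \<in> V \<and> j \<in> V \<and> i \<noteq> j \<and> N (x i - x j) \<le> r}"

text \<open>\<open>b e\<close> says whether \<open>e\<close> is to be inserted; it only matters for non-edges \<open>e\<close> of the graph.\<close>

definition insert_edges :: "nat set \<Rightarrow> nat set set \<Rightarrow> (nat set \<Rightarrow> bool) \<Rightarrow> nat set set" where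
  "insert_edges V E b = E \<union> {e \<in> [V]\<^bsup>2\<^esup> - E. b e}"

definition long_edge ::
    "(real ^ 'd \<Rightarrow> real) \<Rightarrow> real \<Rightarrow> (nat \<Rightarrow> real ^ 'd) \<Rightarrow> nat set set \<Rightarrow> nat \<Rightarrow> nat \<Rightarrow> bool" where
  "long_edge N r x E u v \<longleftrightarrow> {u, v} \<in> E \<and> N (x u - x v) > 3 * r"

definition edge_clique_number :: "nat set \<Rightarrow> nat set set \<Rightarrow> nat \<Rightarrow> nat \<Rightarrow> nat" where
  "edge_clique_number V E u v = Max {card K | K. K \<subseteq> V \<and> clique K E \<and> u \<in> K \<and> v \<in> K}"

text \<open>The sample points are \<open>X 0, X 1, \<dots>\<close>, so that the first \<open>n\<close> of them are indexed by \<open>{..<n}\<close>.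
  For each \<open>n\<close> there is a coin \<open>Z n e\<close> with success probability \<open>q n\<close> for every pair \<open>e\<close>, and the
  sample points together with the coins for this \<open>n\<close> are jointly independent. Nothing is assumed
  about the joint law of coins for different \<open>n\<close>.\<close>

locale noisy_rgg = prob_space M
  for M :: "'w measure" +
  fixes N :: "real ^ 'd \<Rightarrow> real"
    and f :: "real ^ 'd \<Rightarrow> real"
    and r :: "nat \<Rightarrow> real"
    and q :: "nat \<Rightarrow> real"
    and X :: "nat \<Rightarrow> 'w \<Rightarrow> real ^ 'd"
    and Z :: "nat \<Rightarrow> nat set \<Rightarrow> 'w \<Rightarrow> bool"
  assumes norm: "is_norm N"
    and density_measurable: "f \<in> borel_measurable lborel"
    and density_nonneg: "\<And>x. 0 \<le> f x"
    and density_bounded: "bounded (range f)"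
    and radius_pos: "\<And>n. 0 < r n"
    and radius_tendsto: "r \<longlonglongrightarrow> 0"
    and q_bounds: "\<And>n. 0 \<le> q n \<and> q n \<le> 1"
    and X_measurable: "\<And>i. X i \<in> borel_measurable M"
    and X_law: "\<And>i. distr M borel (X i) = density lborel (\<lambda>x. ennreal (f x))"
    and Z_measurable: "\<And>n e. e \<in> [{..<n}]\<^bsup>2\<^esup> \<Longrightarrow> Z n e \<in> M \<rightarrow>\<^sub>M count_space UNIV"
    and Z_law: "\<And>n e. e \<in> [{..<n}]\<^bsup>2\<^esup> \<Longrightarrow> prob {\<omega> \<in> space M. Z n e \<omega>} = q n"
    and indep: "\<And>n. indep_sets
        (case_sum (\<lambda>i. sets (vimage_algebra (space M) (X i) borel))
                  (\<lambda>e. sets (vimage_algebra (space M) (Z n e) (count_space UNIV))))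
        (UNIV <+> [{..<n}]\<^bsup>2\<^esup>)"

text \<open>The edge set of the (0,q)-perturbed random geometric graph on \<open>n\<close> points, in outcome \<open>\<omega>\<close>.\<close>

definition noisy_edges ::
    "(real ^ 'd \<Rightarrow> real) \<Rightarrow> (nat \<Rightarrow> real) \<Rightarrow> (nat \<Rightarrow> 'w \<Rightarrow> real ^ 'd) \<Rightarrow>
     (nat \<Rightarrow> nat set \<Rightarrow> 'w \<Rightarrow> bool) \<Rightarrow> nat \<Rightarrow> 'w \<Rightarrow> nat set set" where
  "noisy_edges N r X Z n \<omega> =
     insert_edges {..<n} (rgg_edges N (r n) (\<lambda>i. X i \<omega>) {..<n}) (\<lambda>e. Z n e \<omega>)"

definition whp :: "'w measure \<Rightarrow> (nat \<Rightarrow> 'w \<Rightarrow> bool) \<Rightarrow> bool" where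
  "whp M A \<longleftrightarrow> (\<lambda>n. measure M {\<omega> \<in> space M. A n \<omega>}) \<longlonglongrightarrow> 1"

end

theory Submission
  imports Defs
begin

text \<open>Take \<open>C = 1/2\<close>. Let \<open>D\<close> be a large multiple of \<open>log n\<close>, which has the order of
  \<open>n r\<^sup>d\<close>. The bounded density and a union bound over stars show that with high probability no point
  has \<open>D\<close> others within distance \<open>r\<close>. A clique on \<open>k = 4 D + 1\<close> vertices then contains at least \<open>k D\<close>
  inserted edges, and a union bound over all \<open>k\<close>-sets gives probability at most
  \<open>n\<^sup>k 2\<^bsup>-kD\<^esup> = (n / 2\<^sup>D)\<^sup>k\<close>, which tends to 0. So with high probability
  every clique has \<open>O(log n)\<close> vertices.\<close>

section \<open>Norms on R^d: continuity and comparison with the Euclidean norm\<close>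

lemma is_norm_minus_commute:
  assumes "is_norm N"
  shows "N (x - y) = N (y - x)"
proof -
  have "N ((-1) *\<^sub>R (x - y)) = \<bar>-1\<bar> * N (x - y)"
    using assms unfolding is_norm_def by blast
  then show ?thesis by simp
qed

text \<open>A norm is convex by the triangle inequality and homogeneity, and a convex function on a
  whole finite-dimensional space is continuous.\<close>

lemma is_norm_continuous:
  assumes "is_norm (N :: real ^ 'd \<Rightarrow> real)"
  shows "continuous_on UNIV N"
proof (rule convex_on_continuous)
  show "convex_on UNIV N"
  proof (rule convex_onI)
    fix t :: real and x y :: "real ^ 'd"
    assume "0 < t" "t < 1"
    have "N ((1 - t) *\<^sub>R x + t *\<^sub>R y) \<le> N ((1 - t) *\<^sub>R x) + N (t *\<^sub>R y)"
      using assms unfolding is_norm_def by blast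
    also have "\<dots> = \<bar>1 - t\<bar> * N x + \<bar>t\<bar> * N y"
      using assms unfolding is_norm_def by metis
    finally show "N ((1 - t) *\<^sub>R x + t *\<^sub>R y) \<le> (1 - t) * N x + t * N y"
      using \<open>0 < t\<close> \<open>t < 1\<close> by simp
  qed auto
qed auto

text \<open>By compactness \<open>N\<close> attains its minimum on the Euclidean unit sphere, and it
  is positive because \<open>N\<close> vanishes only at 0; homogeneity extends the bound to all
  vectors. This places \<open>N\<close>-balls inside Euclidean balls, whose volume is known.\<close>

lemma is_norm_ge_norm:
  assumes N: "is_norm (N :: real ^ 'd \<Rightarrow> real)"
  obtains a where "a > 0" "\<And>x. a * norm x \<le> N x"
proof -
  have "continuous_on (sphere 0 1) N"
    using is_norm_continuous[OF N] continuous_on_subset by blast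
  moreover have "sphere (0 :: real ^ 'd) 1 \<noteq> {}"
    by simp
  ultimately obtain m where m: "m \<in> sphere 0 1" "\<And>x. x \<in> sphere 0 1 \<Longrightarrow> N m \<le> N x"
    using continuous_attains_inf[of "sphere (0 :: real ^ 'd) 1" N] by auto
  show ?thesis
  proof
    have "m \<noteq> 0" using m(1) by auto
    then show "N m > 0"
      using N unfolding is_norm_def by (metis order_le_less)
    fix x :: "real ^ 'd"
    show "N m * norm x \<le> N x"
    proof (cases "x = 0")
      case True
      then show ?thesis using N unfolding is_norm_def by simp
    next
      case False
      have "N m \<le> N ((1 / norm x) *\<^sub>R x)"
        using False by (intro m(2)) simp
      also have "\<dots> = \<bar>1 / norm x\<bar> * N x"
        using N unfolding is_norm_def by blast
      finally show ?thesis using False by (simp add: field_simps)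
    qed
  qed
qed

section \<open>Numerical estimates for the union bounds\<close>

text \<open>The quotient \<open>n ^ n / fact n\<close> is a single term of the series of
  \<open>exp n\<close>.\<close>

lemma power_le_exp_fact: "real n ^ n \<le> exp (real n) * fact n"
proof -
  have "(\<Sum>k\<in>{n}. real n ^ k /\<^sub>R fact k) \<le> exp (real n)"
    unfolding exp_def by (rule sum_le_suminf) (use summable_exp[of "real n"] in auto)
  then show ?thesis by (simp add: field_simps)
qed

text \<open>Bounding \<open>n choose k\<close> by \<open>n ^ k / fact k\<close> and
  \<open>fact k\<close> from below by \<open>(k / exp 1) ^ k\<close> leaves, for
  \<open>k > 0\<close>, at most \<open>(exp 1 * n * p / k) ^ k\<close>; the hypothesis makes this
  base at most \<open>exp (-2)\<close>.\<close>

lemma binomial_mult_power_le: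
  fixes p :: real
  assumes "0 \<le> p" "exp 3 * (real n * p) \<le> real k"
  shows "real (n choose k) * p ^ k \<le> exp (- 2 * real k)"
proof -
  have "real ((n choose k) * fact k) \<le> real (n ^ k)"
    by (subst of_nat_le_iff) (rule binomial_fact_pow)
  then have "exp (3 * real k) * (real (n choose k) * fact k * p ^ k) \<le> exp (3 * real k) * (real n ^ k * p ^ k)"
    using assms by (intro mult_left_mono mult_right_mono) auto
  also have "\<dots> = (exp 3 * (real n * p)) ^ k"
    by (simp add: power_mult_distrib exp_of_nat_mult[symmetric] mult.commute)
  also have "\<dots> \<le> real k ^ k"
    using assms by (intro power_mono) auto
  also have "\<dots> \<le> exp (real k) * fact k"
    by (rule power_le_exp_fact)
  finally have "fact k * (exp (3 * real k) * (real (n choose k) * p ^ k)) \<le> fact k * exp (real k)"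
    by (simp add: mult_ac)
  then have "exp (3 * real k) * (real (n choose k) * p ^ k) \<le> exp (real k)"
    by (simp only: mult_le_cancel_left_pos[OF fact_gt_zero])
  then have "real (n choose k) * p ^ k \<le> exp (real k) / exp (3 * real k)"
    by (simp add: field_simps)
  also have "\<dots> = exp (- 2 * real k)"
    by (simp flip: exp_diff)
  finally show ?thesis .
qed

text \<open>The first summand will bound the probability of a star with \<open>D\<close> leaves, the
  second that of \<open>4 * D + 1\<close> vertices with \<open>(4 * D + 1) * D\<close> inserted
  edges among them. Each is at most \<open>1 / n\<close>.\<close>

lemma clique_union_bound:
  fixes b :: real
  assumes n: "1 \<le> n" and b: "0 \<le> b" and D: "exp 3 * (real n * b) \<le> real D" "4 * ln (real n) \<le> real D"
  shows "real n * (real (n choose D) * b ^ D) + real (n choose (4 * D + 1)) * (1 / 2) ^ ((4 * D + 1) * D) \<le> 2 / real n"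
proof -
  have ln_n: "0 \<le> ln (real n)" using n by simp
  have "real (n choose D) * b ^ D \<le> exp (- 2 * real D)"
    by (rule binomial_mult_power_le[OF b D(1)])
  also have "\<dots> \<le> exp (- 2 * ln (real n))"
    using D(2) ln_n by simp
  also have "\<dots> = 1 / (real n * real n)"
    using n by (simp add: exp_minus exp_double power2_eq_square field_simps)
  finally have "real n * (real (n choose D) * b ^ D) \<le> real n * (1 / (real n * real n))"
    using n by (intro mult_left_mono) auto
  then have 1: "real n * (real (n choose D) * b ^ D) \<le> 1 / real n"
    using n by simp
  \<comment> \<open>\<open>2 ^ D\<close> has to reach \<open>n ^ 2\<close>, not only
    \<open>n\<close>, so that the base \<open>n / 2 ^ D\<close> of the second summand is at most
    \<open>1 / n\<close>.\<close>
  have "real n * real n = exp (2 * ln (real n))"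
    using n by (simp add: exp_double power2_eq_square)
  also have "\<dots> \<le> exp (real D * ln 2)"
  proof -
    have "2 * ln (real n) \<le> real D * (1 / 2)" using D(2) by simp
    also have "\<dots> \<le> real D * ln 2"
      using ln2_ge_two_thirds by (intro mult_left_mono) auto
    finally show ?thesis by simp
  qed
  also have "\<dots> = 2 ^ D"
    by (simp add: exp_of_nat_mult)
  finally have two: "real n * (1 / 2) ^ D \<le> 1 / real n"
    using n by (simp add: field_simps power_divide)
  have "real (n choose (4 * D + 1)) \<le> real n ^ (4 * D + 1)"
  proof (cases "4 * D + 1 \<le> n")
    case True
    then show ?thesis
      using binomial_le_pow[OF True] of_nat_mono by fastforce
  qed (simp add: binomial_eq_0)
  then have "real (n choose (4 * D + 1)) * (1 / 2) ^ ((4 * D + 1) * D)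
      \<le> real n ^ (4 * D + 1) * (1 / 2) ^ ((4 * D + 1) * D)"
    by (rule mult_right_mono) simp
  also have "\<dots> = (real n * (1 / 2) ^ D) ^ (4 * D + 1)"
    by (simp only: power_mult_distrib power_mult[symmetric] mult.commute[of D])
  also have "\<dots> \<le> (1 / real n) ^ (4 * D + 1)"
    using two by (intro power_mono) auto
  also have "\<dots> \<le> (1 / real n) ^ 1"
    using n by (intro power_decreasing) auto
  finally show ?thesis using 1 by simp
qed

section \<open>Deterministic facts about geometric graphs and cliques\<close>

lemma rgg_edges_subset: "rgg_edges N \<rho> x V \<subseteq> [V]\<^bsup>2\<^esup>"
  unfolding rgg_edges_def by (auto simp: nsets_def)

lemma noisy_edges_subset: "noisy_edges N r X Z n \<omega> \<subseteq> [{..<n}]\<^bsup>2\<^esup>"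
  unfolding noisy_edges_def insert_edges_def using rgg_edges_subset by blast

lemma doubleton_mem_rgg_edges_iff:
  assumes "is_norm N"
  shows "{i, j} \<in> rgg_edges N \<rho> x V \<longleftrightarrow> i \<in> V \<and> j \<in> V \<and> i \<noteq> j \<and> N (x i - x j) \<le> \<rho>"
  unfolding rgg_edges_def
  by (auto simp: doubleton_eq_iff is_norm_minus_commute[OF assms, of "x j" "x i"])

text \<open>A set of \<open>4 * D + 1\<close> vertices has exactly \<open>2 * D\<close> pairs per
  vertex. Charging every short pair to an endpoint uses at most \<open>D\<close> per vertex, so at
  least \<open>D\<close> per vertex remain.\<close>

lemma card_non_rgg_edges:
  assumes K: "finite K" "card K = 4 * D + 1"
    and deg: "\<And>i. i \<in> K \<Longrightarrow> card {j \<in> K. j \<noteq> i \<and> N (x i - x j) \<le> \<rho>} \<le> D"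
  shows "card K * D \<le> card ([K]\<^bsup>2\<^esup> - rgg_edges N \<rho> x K)"
proof -
  let ?nb = "\<lambda>i. {j \<in> K. j \<noteq> i \<and> N (x i - x j) \<le> \<rho>}"
  have "rgg_edges N \<rho> x K \<subseteq> (\<Union>i\<in>K. (\<lambda>j. {i, j}) ` ?nb i)"
  proof
    fix e assume "e \<in> rgg_edges N \<rho> x K"
    then obtain i j where "e = {i, j}" "i \<in> K" "j \<in> ?nb i"
      unfolding rgg_edges_def mem_Collect_eq by metis
    then show "e \<in> (\<Union>i\<in>K. (\<lambda>j. {i, j}) ` ?nb i)"
      by (intro UN_I[of i] image_eqI[of _ _ j])
  qed
  then have "card (rgg_edges N \<rho> x K) \<le> card (\<Union>i\<in>K. (\<lambda>j. {i, j}) ` ?nb i)"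
    using K(1) by (intro card_mono) auto
  also have "\<dots> \<le> (\<Sum>i\<in>K. card ((\<lambda>j. {i, j}) ` ?nb i))"
    by (rule card_UN_le[OF K(1)])
  also have "\<dots> \<le> (\<Sum>i\<in>K. D)"
    using K(1) deg by (intro sum_mono order.trans[OF card_image_le]) auto
  finally have 1: "card (rgg_edges N \<rho> x K) \<le> card K * D"
    by simp
  have "card ([K]\<^bsup>2\<^esup>) = card K choose 2"
    by (rule card_nsets)
  also have "\<dots> = card K * (2 * D)"
    unfolding choose_two K(2) by simp
  finally have 2: "card ([K]\<^bsup>2\<^esup>) = card K * (2 * D)" .
  have "card ([K]\<^bsup>2\<^esup> - rgg_edges N \<rho> x K) = card ([K]\<^bsup>2\<^esup>) - card (rgg_edges N \<rho> x K)"
    using K(1) by (intro card_Diff_subset rgg_edges_subset) (metis finite_imp_finite_nsets finite_subset rgg_edges_subset)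
  then show ?thesis using 1 2 by simp
qed

text \<open>Subsets of cliques are cliques, so excluding the one size \<open>Suc k\<close> excludes
  all larger sizes. The maximum is over a nonempty set because \<open>{u, v}\<close> itself is a
  clique.\<close>

lemma edge_clique_number_le:
  assumes V: "finite V" and E: "E \<subseteq> [V]\<^bsup>2\<^esup>" and uv: "{u, v} \<in> E"
    and no: "\<And>K. K \<subseteq> V \<Longrightarrow> clique K E \<Longrightarrow> card K \<noteq> Suc k"
  shows "edge_clique_number V E u v \<le> k"
  unfolding edge_clique_number_def
proof (rule Max.boundedI)
  let ?S = "{card K |K. K \<subseteq> V \<and> clique K E \<and> u \<in> K \<and> v \<in> K}"
  have "?S \<subseteq> card ` Pow V" by auto
  then show "finite ?S" using V by (meson finite_Pow_iff finite_imageI finite_subset)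
  have "clique {u, v} E"
    using uv unfolding clique_def by (metis insert_commute insertE singletonD)
  moreover have "{u, v} \<subseteq> V" using uv E by (auto simp: nsets_def)
  ultimately show "?S \<noteq> {}" by blast
  fix c assume "c \<in> ?S"
  then obtain K where K: "c = card K" "K \<subseteq> V" "clique K E" by auto
  show "c \<le> k"
  proof (rule ccontr)
    assume "\<not> c \<le> k"
    then obtain K' where "K' \<subseteq> K" "card K' = Suc k"
      using K(1) obtain_subset_with_card_n[of "Suc k" K] by auto
    moreover from this have "clique K' E"
      using K(3) unfolding clique_def by blast
    ultimately show False
      using no K(2) by blast
  qed
qed

section \<open>Independence of the sample points, balls and stars\<close>

context noisy_rgg
begin

lemma norm_measurable [measurable]: "N \<in> borel_measurable borel"
  using is_norm_continuous[OF norm] by (rule borel_measurable_continuous_onI)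

text \<open>The points are the left summands of the joint family; any \<open>n\<close> serves, and 0
  leaves no coins. Singleton blocks \<open>{Inl j}\<close> recast the families in the
  \<open>sigma_sets\<close> form used by \<open>indep_vars\<close>.\<close>

lemma indep_points: "indep_vars (\<lambda>_. borel) X UNIV"
proof -
  let ?E = "case_sum (\<lambda>i. sets (vimage_algebra (space M) (X i) borel))
                  (\<lambda>e. sets (vimage_algebra (space M) (Z 0 e) (count_space UNIV)))"
  have "indep_sets (\<lambda>j. sigma_sets (space M) (\<Union>i\<in>{Inl j}. ?E i)) UNIV"
  proof (rule indep_sets_collect_sigma)
    show "indep_sets ?E (\<Union>j\<in>UNIV. {Inl j})"
      by (rule indep_sets_mono_index[OF _ indep[of 0]]) auto
    show "Int_stable (?E i)" if "i \<in> {Inl j}" for i j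
      using that by (auto simp: Int_stable_def)
  qed (auto simp: disjoint_family_on_def)
  moreover have "sigma_sets (space M) (\<Union>i\<in>{Inl j}. ?E i) =
      sigma_sets (space M) {X j -` A \<inter> space M |A. A \<in> sets borel}" for j
    using sets.sigma_sets_eq[of "vimage_algebra (space M) (X j) borel"]
    by (simp add: sets_vimage_algebra)
  ultimately show ?thesis
    unfolding indep_vars_def using X_measurable by simp
qed

text \<open>The density is at most some \<open>F\<close>, and the \<open>N\<close>-ball lies in a
  Euclidean ball of radius \<open>\<rho> / a\<close>, whose volume is a constant times
  \<open>\<rho> ^ CARD('d)\<close>. One \<open>B\<close> serves all points, centres and
  radii.\<close>

lemma prob_ball_le:
  obtains B where "B > 0"
    "\<And>i c \<rho>. 0 < \<rho> \<Longrightarrow>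
      emeasure (distr M borel (X i)) {x. N (c - x) \<le> \<rho>} \<le> ennreal (B * \<rho> ^ CARD('d))"
proof -
  obtain a where a: "a > 0" "\<And>x. a * norm x \<le> N x"
    using is_norm_ge_norm[OF norm] by blast
  obtain F where F: "F > 0" "\<And>x. \<bar>f x\<bar> \<le> F"
    using density_bounded unfolding bounded_pos by auto
  let ?B = "F * (unit_ball_vol (real CARD('d)) / a ^ CARD('d))"
  show ?thesis
  proof
    show "?B > 0" using a F by simp
    fix i c and \<rho> :: real assume \<rho>: "0 < \<rho>"
    have sub: "{x. N (c - x) \<le> \<rho>} \<subseteq> cball c (\<rho> / a)"
    proof
      fix x assume "x \<in> {x. N (c - x) \<le> \<rho>}"
      then have "a * norm (c - x) \<le> \<rho>"
        using a(2)[of "c - x"] by simp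
      then show "x \<in> cball c (\<rho> / a)"
        using a(1) by (simp add: dist_norm field_simps)
    qed
    have "emeasure (distr M borel (X i)) {x. N (c - x) \<le> \<rho>} \<le>
        emeasure (density lborel (\<lambda>x. ennreal (f x))) (cball c (\<rho> / a))"
      unfolding X_law by (rule emeasure_mono[OF sub]) simp
    also have "\<dots> = (\<integral>\<^sup>+ x. ennreal (f x) * indicator (cball c (\<rho> / a)) x \<partial>lborel)"
      using density_measurable by (intro emeasure_density) auto
    also have "\<dots> \<le> (\<integral>\<^sup>+ x. ennreal F * indicator (cball c (\<rho> / a)) x \<partial>lborel)"
      using F by (intro nn_integral_mono mult_right_mono ennreal_leI) (auto simp: abs_le_iff)
    also have "\<dots> = ennreal F * emeasure lborel (cball c (\<rho> / a))"
      by (subst nn_integral_cmult_indicator) auto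
    also have "\<dots> = ennreal F * ennreal (unit_ball_vol (real CARD('d)) * (\<rho> / a) ^ CARD('d))"
      using a \<rho> by (subst emeasure_cball) auto
    also have "\<dots> = ennreal (?B * \<rho> ^ CARD('d))"
      using F a \<rho> by (subst ennreal_mult[symmetric]) (auto simp: power_divide)
    finally show "emeasure (distr M borel (X i)) {x. N (c - x) \<le> \<rho>} \<le> ennreal (?B * \<rho> ^ CARD('d))" .
  qed
qed

text \<open>Once the centre \<open>X i\<close> is fixed at \<open>c\<close>, the leaves are
  independent and each lies in the ball around \<open>c\<close> with probability at most
  \<open>b\<close>; integrating over \<open>c\<close> (Fubini) keeps the bound.\<close>

lemma prob_star_le:
  assumes S: "finite S" "i \<notin> S" and b: "0 \<le> b"
    and ball: "\<And>j c. emeasure (distr M borel (X j)) {x. N (c - x) \<le> \<rho>} \<le> ennreal b"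
  shows "prob {\<omega> \<in> space M. \<forall>j\<in>S. N (X i \<omega> - X j \<omega>) \<le> \<rho>} \<le> b ^ card S"
proof -
  let ?I = "insert i S"
  let ?\<nu> = "\<lambda>j. distr M borel (X j)"
  let ?A = "{y \<in> space (Pi\<^sub>M ?I (\<lambda>_. borel)). \<forall>j\<in>S. N (y i - y j) \<le> \<rho>}"
  note X_measurable [measurable]
  interpret \<nu>: prob_space "?\<nu> j" for j
    by (rule prob_space_distr) simp
  interpret P: product_prob_space ?\<nu> UNIV
    by unfold_locales
  have sets_P: "sets (Pi\<^sub>M J ?\<nu>) = sets (Pi\<^sub>M J (\<lambda>_. borel))" for J
    by (rule sets_PiM_cong) auto
  have "indep_vars (\<lambda>_. borel) X ?I"
    by (rule indep_vars_subset[OF indep_points]) simp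
  then have distr: "distr M (Pi\<^sub>M ?I (\<lambda>_. borel)) (\<lambda>\<omega>. \<lambda>j\<in>?I. X j \<omega>) = Pi\<^sub>M ?I ?\<nu>"
    by (subst (asm) indep_vars_iff_distr_eq_PiM') auto
  have A [measurable]: "?A \<in> sets (Pi\<^sub>M ?I (\<lambda>_. borel))"
  proof (rule sets.sets_Collect_finite_All[OF _ S(1)])
    fix j assume "j \<in> S"
    then have [measurable]: "(\<lambda>y. y i) \<in> borel_measurable (Pi\<^sub>M ?I (\<lambda>_. borel))"
        "(\<lambda>y. y j) \<in> borel_measurable (Pi\<^sub>M ?I (\<lambda>_. borel))"
      by (auto intro!: measurable_component_singleton)
    show "{y \<in> space (Pi\<^sub>M ?I (\<lambda>_. borel)). N (y i - y j) \<le> \<rho>} \<in> sets (Pi\<^sub>M ?I (\<lambda>_. borel))"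
      by measurable
  qed
  then have A': "?A \<in> sets (Pi\<^sub>M ?I ?\<nu>)"
    by (simp add: sets_P)
  have "emeasure M {\<omega> \<in> space M. \<forall>j\<in>S. N (X i \<omega> - X j \<omega>) \<le> \<rho>} = emeasure (Pi\<^sub>M ?I ?\<nu>) ?A"
    unfolding distr[symmetric]
    by (subst emeasure_distr[OF _ A]) (auto intro!: arg_cong[where f = "emeasure M"] simp: space_PiM)
  also have "\<dots> = (\<integral>\<^sup>+ y. indicator ?A y \<partial>Pi\<^sub>M ?I ?\<nu>)"
    using A' by simp
  also have "\<dots> = (\<integral>\<^sup>+ c. (\<integral>\<^sup>+ y. indicator ?A (y(i := c)) \<partial>Pi\<^sub>M S ?\<nu>) \<partial>?\<nu> i)"
    using S A' by (intro P.product_nn_integral_insert_rev) auto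
  also have "\<dots> \<le> (\<integral>\<^sup>+ c. ennreal (b ^ card S) \<partial>?\<nu> i)"
  proof (rule nn_integral_mono)
    fix c
    \<comment> \<open>As \<open>i\<close> is not in \<open>S\<close>, overwriting coordinate
      \<open>i\<close> leaves the leaves untouched, so for fixed \<open>c\<close> the star event is
      a product of balls.\<close>
    have "(\<integral>\<^sup>+ y. indicator ?A (y(i := c)) \<partial>Pi\<^sub>M S ?\<nu>) =
        (\<integral>\<^sup>+ y. indicator (Pi\<^sub>E S (\<lambda>_. {x. N (c - x) \<le> \<rho>})) y \<partial>Pi\<^sub>M S ?\<nu>)"
      using S by (intro nn_integral_cong)
        (auto simp: indicator_def space_PiM PiE_iff extensional_def split: if_splits)
    also have "\<dots> = emeasure (Pi\<^sub>M S ?\<nu>) (Pi\<^sub>E S (\<lambda>_. {x. N (c - x) \<le> \<rho>}))"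
      using S by (intro nn_integral_indicator sets_PiM_I_finite) auto
    also have "\<dots> = (\<Prod>j\<in>S. emeasure (?\<nu> j) {x. N (c - x) \<le> \<rho>})"
      using S by (intro P.emeasure_PiM) auto
    also have "\<dots> \<le> (\<Prod>j\<in>S. ennreal b)"
      using ball by (intro prod_mono_ennreal)
    also have "\<dots> = ennreal (b ^ card S)"
      using b by (simp add: ennreal_power)
    finally show "(\<integral>\<^sup>+ y. indicator ?A (y(i := c)) \<partial>Pi\<^sub>M S ?\<nu>) \<le> ennreal (b ^ card S)" .
  qed
  also have "\<dots> = ennreal (b ^ card S)"
    using \<nu>.emeasure_space_1[of i] by simp
  finally show ?thesis
    using b by (simp add: emeasure_eq_measure)
qed

section \<open>Geometric edge patterns and their independence from the coins\<close>

text \<open>A pattern on a finite vertex set is a finite conjunction of distance conditions. The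
  space \<open>L\<close> is general because both \<open>M\<close> and the sigma-algebra generated by
  the points are needed.\<close>

lemma sets_rgg_edges_eq:
  assumes [measurable]: "\<And>i. Y i \<in> borel_measurable L" and K: "finite K"
  shows "{\<omega> \<in> space L. rgg_edges N \<rho> (\<lambda>i. Y i \<omega>) K = H} \<in> sets L"
proof (cases "H \<subseteq> [K]\<^bsup>2\<^esup>")
  case True
  have "rgg_edges N \<rho> (\<lambda>i. Y i \<omega>) K = H \<longleftrightarrow>
      (\<forall>i\<in>K. \<forall>j\<in>K. i \<noteq> j \<longrightarrow> (N (Y i \<omega> - Y j \<omega>) \<le> \<rho> \<longleftrightarrow> {i, j} \<in> H))" (is "?G = H \<longleftrightarrow> ?R") for \<omega>
  proof
    assume "?G = H"
    then show ?R by (auto simp: doubleton_mem_rgg_edges_iff[OF norm])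
  next
    assume ?R
    then have "e \<in> ?G \<longleftrightarrow> e \<in> H" if "e \<in> [K]\<^bsup>2\<^esup>" for e
      using that by (auto simp: nsets_def card_2_iff doubleton_mem_rgg_edges_iff[OF norm])
    then show "?G = H"
      using True rgg_edges_subset by blast
  qed
  then show ?thesis using K by simp
next
  case False
  then have "{\<omega> \<in> space L. rgg_edges N \<rho> (\<lambda>i. Y i \<omega>) K = H} = {}"
    using rgg_edges_subset by blast
  then show ?thesis by (metis sets.empty_sets)
qed

text \<open>Regrouping an independent family into disjoint blocks keeps it independent: all points
  together form one block, which contains \<open>A\<close>, and each coin is a block of its
  own.\<close>

lemma prob_points_and_coins:
  assumes A: "A \<in> sigma_sets (space M) (\<Union>i. sets (vimage_algebra (space M) (X i) borel))"
    and T: "finite T" "T \<subseteq> [{..<n}]\<^bsup>2\<^esup>"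
  shows "prob {\<omega> \<in> A. \<forall>e\<in>T. Z n e \<omega>} = prob A * q n ^ card T"
proof -
  let ?E = "case_sum (\<lambda>i. sets (vimage_algebra (space M) (X i) borel))
                  (\<lambda>e. sets (vimage_algebra (space M) (Z n e) (count_space UNIV)))"
  \<comment> \<open>\<open>None\<close> indexes the block of all points, \<open>Some e\<close> the single coin of \<open>e\<close>.\<close>
  define I where "I = case_option (range Inl) (\<lambda>e. {Inr e :: nat + nat set})"
  have A_sub: "A \<subseteq> space M"
    by (rule sigma_sets_into_sp[OF _ A]) (use sets.sets_into_space in fastforce)
  let ?F = "\<lambda>j. sigma_sets (space M) (\<Union>i\<in>I j. ?E i)"
  define B where "B = case_option A (\<lambda>e. {\<omega> \<in> space M. Z n e \<omega>})"
  have "indep_sets ?F (insert None (Some ` [{..<n}]\<^bsup>2\<^esup>))"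
  proof (rule indep_sets_collect_sigma)
    show "indep_sets ?E (\<Union>j\<in>insert None (Some ` [{..<n}]\<^bsup>2\<^esup>). I j)"
      by (rule indep_sets_mono_index[OF _ indep[of n]]) (auto simp: I_def)
    show "Int_stable (?E i)" if "i \<in> I j" for i j
      by (cases i) (auto simp: Int_stable_def)
    show "disjoint_family_on I (insert None (Some ` [{..<n}]\<^bsup>2\<^esup>))"
      by (auto simp: disjoint_family_on_def I_def)
  qed
  moreover have "\<forall>j\<in>insert None (Some ` T). B j \<in> ?F j"
  proof
    fix j assume "j \<in> insert None (Some ` T)"
    show "B j \<in> ?F j"
    proof (cases j)
      case None
      then show ?thesis using A by (simp add: B_def I_def)
    next
      case (Some e)
      have "B j = Z n e -` {True} \<inter> space M" by (auto simp: B_def Some)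
      also have "\<dots> \<in> ?E (Inr e)" by (simp add: in_vimage_algebra)
      finally show ?thesis using Some by (auto simp: I_def)
    qed
  qed
  ultimately have "prob (\<Inter>j\<in>insert None (Some ` T). B j) = (\<Prod>j\<in>insert None (Some ` T). prob (B j))"
    using T by (intro indep_setsD) auto
  also have "(\<Inter>j\<in>insert None (Some ` T). B j) = {\<omega> \<in> A. \<forall>e\<in>T. Z n e \<omega>}"
    using A_sub by (auto simp: B_def)
  also have "(\<Prod>j\<in>insert None (Some ` T). prob (B j)) = prob A * (\<Prod>e\<in>T. prob (B (Some e)))"
    using T by (simp add: B_def prod.reindex)
  also have "(\<Prod>e\<in>T. prob (B (Some e))) = (\<Prod>e\<in>T. q n)"
    using T Z_law by (intro prod.cong) (auto simp: B_def)
  finally show ?thesis by simp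
qed

text \<open>Splitting over the geometric edge pattern \<open>H\<close> on \<open>K\<close> fixes the set of coins that have to succeed, so
  that independence of points and coins applies to each piece.\<close>

lemma prob_missing_edges_inserted_le:
  fixes m :: nat and \<rho> :: real
  assumes K: "K \<subseteq> {..<n}" and c: "q n \<le> c" "c \<le> 1"
  defines "A \<equiv> {\<omega> \<in> space M. m \<le> card ([K]\<^bsup>2\<^esup> - rgg_edges N \<rho> (\<lambda>i. X i \<omega>) K) \<and>
    (\<forall>e\<in>[K]\<^bsup>2\<^esup> - rgg_edges N \<rho> (\<lambda>i. X i \<omega>) K. Z n e \<omega>)}"
  shows "A \<in> events" "prob A \<le> c ^ m"
proof -
  let ?G = "\<lambda>\<omega>. rgg_edges N \<rho> (\<lambda>i. X i \<omega>) K"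
  \<comment> \<open>Measurability of the pattern in \<open>M\<close> is too weak for independence
    from the coins: its event must lie in the sigma-algebra of the points alone, which is that of
    \<open>?L\<close>.\<close>
  let ?L = "sigma (space M) (\<Union>i. sets (vimage_algebra (space M) (X i) borel))"
  define \<H> where "\<H> = {H \<in> Pow ([K]\<^bsup>2\<^esup>). m \<le> card ([K]\<^bsup>2\<^esup> - H)}"
  define R where "R H = {\<omega> \<in> space M. ?G \<omega> = H}" for H
  define S where "S H = {\<omega> \<in> R H. \<forall>e\<in>[K]\<^bsup>2\<^esup> - H. Z n e \<omega>}" for H
  have K_fin: "finite K"
    using K finite_subset by blast
  then have K2_fin: "finite ([K]\<^bsup>2\<^esup>)"
    by (rule finite_imp_finite_nsets)
  have K2: "[K]\<^bsup>2\<^esup> \<subseteq> [{..<n}]\<^bsup>2\<^esup>"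
    using K by (rule nsets_mono)
  have \<H>_fin: "finite \<H>"
    unfolding \<H>_def using K2_fin by simp
  have R_events: "R H \<in> events" for H
    unfolding R_def by (rule sets_rgg_edges_eq[OF X_measurable K_fin])
  have L_sub: "(\<Union>i. sets (vimage_algebra (space M) (X i) borel)) \<subseteq> Pow (space M)"
    using sets.sets_into_space by fastforce
  have "X i \<in> borel_measurable ?L" for i
  proof (rule measurableI)
    show "X i -` B \<inter> space ?L \<in> sets ?L" if "B \<in> sets borel" for B
      using that L_sub by (auto intro!: in_vimage_algebra sigma_sets.Basic)
  qed auto
  then have "{\<omega> \<in> space ?L. ?G \<omega> = H} \<in> sets ?L" for H
    by (rule sets_rgg_edges_eq[OF _ K_fin])
  then have R_sigma: "R H \<in> sigma_sets (space M) (\<Union>i. sets (vimage_algebra (space M) (X i) borel))" for H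
    using L_sub by (simp add: R_def)
  have S_events: "S H \<in> events" for H
  proof -
    have "{\<omega> \<in> space M. Z n e \<omega>} \<in> events" if "e \<in> [K]\<^bsup>2\<^esup> - H" for e
    proof -
      have "Z n e -` {True} \<inter> space M \<in> events"
        using that K2 by (intro measurable_sets[OF Z_measurable]) auto
      also have "Z n e -` {True} \<inter> space M = {\<omega> \<in> space M. Z n e \<omega>}"
        by auto
      finally show ?thesis .
    qed
    then have "{\<omega> \<in> space M. \<forall>e\<in>[K]\<^bsup>2\<^esup> - H. Z n e \<omega>} \<in> events"
      using K2_fin by (intro sets.sets_Collect_finite_All) auto
    moreover have "S H = R H \<inter> {\<omega> \<in> space M. \<forall>e\<in>[K]\<^bsup>2\<^esup> - H. Z n e \<omega>}"
      by (auto simp: S_def R_def)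
    ultimately show ?thesis using R_events by auto
  qed
  have A_eq: "A = (\<Union>H\<in>\<H>. S H)"
  proof (intro equalityI subsetI)
    fix \<omega> assume "\<omega> \<in> A"
    then have "?G \<omega> \<in> \<H>" "\<omega> \<in> S (?G \<omega>)"
      using rgg_edges_subset[of N \<rho> "\<lambda>i. X i \<omega>" K] by (simp_all add: A_def \<H>_def S_def R_def)
    then show "\<omega> \<in> (\<Union>H\<in>\<H>. S H)" by blast
  qed (auto simp: A_def \<H>_def S_def R_def)
  then show "A \<in> events"
    using \<H>_fin S_events by auto
  have "prob A \<le> (\<Sum>H\<in>\<H>. prob (S H))"
    unfolding A_eq using \<H>_fin S_events by (intro finite_measure_subadditive_finite) auto
  also have "\<dots> \<le> (\<Sum>H\<in>\<H>. prob (R H) * c ^ m)"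
  proof (rule sum_mono)
    fix H assume H: "H \<in> \<H>"
    have "prob (S H) = prob (R H) * q n ^ card ([K]\<^bsup>2\<^esup> - H)"
      unfolding S_def using R_sigma K2 K2_fin by (intro prob_points_and_coins) auto
    also have "q n ^ card ([K]\<^bsup>2\<^esup> - H) \<le> c ^ card ([K]\<^bsup>2\<^esup> - H)"
      using c q_bounds by (intro power_mono) auto
    also have "c ^ card ([K]\<^bsup>2\<^esup> - H) \<le> c ^ m"
      using H c q_bounds[of n] by (intro power_decreasing) (auto simp: \<H>_def)
    finally show "prob (S H) \<le> prob (R H) * c ^ m"
      by (simp add: mult_left_mono)
  qed
  \<comment> \<open>The pattern events are disjoint, so their probabilities add up to at most 1 and
    the number of patterns costs no factor.\<close>
  also have "\<dots> = prob (\<Union>H\<in>\<H>. R H) * c ^ m"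
    using \<H>_fin R_events
    by (subst finite_measure_finite_Union) (auto simp: disjoint_family_on_def R_def sum_distrib_right)
  also have "\<dots> \<le> 1 * c ^ m"
    using c q_bounds[of n] by (intro mult_right_mono) auto
  finally show "prob A \<le> c ^ m" by simp
qed

section \<open>Measurability of events of the noisy graph\<close>

lemma sets_noisy_edges_eq: "{\<omega> \<in> space M. noisy_edges N r X Z n \<omega> = E} \<in> events"
proof -
  let ?P = "[{..<n}]\<^bsup>2\<^esup>"
  let ?G = "\<lambda>\<omega>. rgg_edges N (r n) (\<lambda>i. X i \<omega>) {..<n}"
  have P_fin: "finite ?P"
    by (rule finite_imp_finite_nsets) simp
  have [measurable]: "Measurable.pred M (Z n e)" if "e \<in> ?P" for e
    using Z_measurable[OF that] .
  have [measurable]: "Measurable.pred M (\<lambda>\<omega>. ?G \<omega> = H)" for H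
    unfolding pred_def by (rule sets_rgg_edges_eq[OF X_measurable]) simp
  have "{\<omega> \<in> space M. noisy_edges N r X Z n \<omega> = E} =
      {\<omega> \<in> space M. \<exists>H\<in>Pow ?P. ?G \<omega> = H \<and> {e \<in> ?P. e \<in> H \<or> Z n e \<omega>} = E}"
    using rgg_edges_subset unfolding noisy_edges_def insert_edges_def by blast
  \<comment> \<open>Comparing pair by pair turns equality of edge sets into a finite conjunction;
    \<open>E \<subseteq> ?P\<close> takes care of everything outside \<open>?P\<close>.\<close>
  also have "\<dots> = {\<omega> \<in> space M. E \<subseteq> ?P \<and> (\<exists>H\<in>Pow ?P. ?G \<omega> = H \<and> (\<forall>e\<in>?P. e \<in> E \<longleftrightarrow> e \<in> H \<or> Z n e \<omega>))}"
    by blast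
  also have "\<dots> \<in> events"
    using P_fin by (intro predE pred_intros_logic pred_intros_finite) auto
  finally show ?thesis .
qed

text \<open>Only finitely many edge sets can occur, and for each fixed \<open>E\<close> the clique
  number is a constant. Measurability is needed for this event to be the larger set in a
  monotonicity step.\<close>

lemma sets_long_edge_clique_number_le:
  "{\<omega> \<in> space M. \<forall>u v. long_edge N \<rho> (\<lambda>i. X i \<omega>) (noisy_edges N r X Z n \<omega>) u v \<longrightarrow>
      real (edge_clique_number {..<n} (noisy_edges N r X Z n \<omega>) u v) \<le> c} \<in> events"
proof -
  let ?P = "[{..<n}]\<^bsup>2\<^esup>"
  let ?E = "noisy_edges N r X Z n"
  have P_fin: "finite (Pow ?P)"
    using finite_imp_finite_nsets[of "{..<n}" 2] by simp
  note X_measurable [measurable]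
  have [measurable]: "Measurable.pred M (\<lambda>\<omega>. ?E \<omega> = E)" for E
    unfolding pred_def by (rule sets_noisy_edges_eq)
  have vert: "u < n" "v < n" if "{u, v} \<in> ?E \<omega>" for u v \<omega>
    using that noisy_edges_subset by (fastforce simp: nsets_def)+
  have "(\<forall>u v. long_edge N \<rho> (\<lambda>i. X i \<omega>) (?E \<omega>) u v \<longrightarrow>
        real (edge_clique_number {..<n} (?E \<omega>) u v) \<le> c) \<longleftrightarrow>
      (\<forall>u\<in>{..<n}. \<forall>v\<in>{..<n}. \<forall>E\<in>Pow ?P. ?E \<omega> = E \<longrightarrow> {u, v} \<in> E \<longrightarrow> N (X u \<omega> - X v \<omega>) > 3 * \<rho> \<longrightarrow>
        real (edge_clique_number {..<n} E u v) \<le> c)" for \<omega>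
    using vert noisy_edges_subset unfolding long_edge_def by (metis PowI lessThan_iff)
  moreover have "{\<omega> \<in> space M. \<forall>u\<in>{..<n}. \<forall>v\<in>{..<n}. \<forall>E\<in>Pow ?P. ?E \<omega> = E \<longrightarrow> {u, v} \<in> E \<longrightarrow>
      N (X u \<omega> - X v \<omega>) > 3 * \<rho> \<longrightarrow> real (edge_clique_number {..<n} E u v) \<le> c} \<in> events"
    by (intro sets.sets_Collect_finite_All P_fin finite_lessThan) measurable
  ultimately show ?thesis by presburger
qed

section \<open>The probability bound for a fixed number of points\<close>

text \<open>There are two bad events: \<open>B1\<close>, where some point has \<open>D\<close>
  others within \<open>r n\<close>, and \<open>B2\<close>, where some \<open>4 * D + 1\<close>
  vertices miss at least \<open>(4 * D + 1) * D\<close> geometric edges and all of these are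
  inserted. Outside both, no clique has \<open>4 * D + 1\<close> vertices.\<close>

lemma prob_long_edge_clique_number_ge:
  assumes b: "0 \<le> b"
    and ball: "\<And>j c. emeasure (distr M borel (X j)) {x. N (c - x) \<le> r n} \<le> ennreal b"
    and c: "q n \<le> c" "c \<le> 1" and C: "real (4 * D) \<le> C"
  shows "1 - (real n * (real (n choose D) * b ^ D) + real (n choose (4 * D + 1)) * c ^ ((4 * D + 1) * D))
    \<le> prob {\<omega> \<in> space M. \<forall>u v. long_edge N (r n) (\<lambda>i. X i \<omega>) (noisy_edges N r X Z n \<omega>) u v \<longrightarrow>
      real (edge_clique_number {..<n} (noisy_edges N r X Z n \<omega>) u v) \<le> C}" (is "1 - (?p1 + ?p2) \<le> prob ?T")
proof -
  let ?k = "4 * D + 1"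
  let ?G = "\<lambda>\<omega> K. rgg_edges N (r n) (\<lambda>i. X i \<omega>) K"
  note X_measurable [measurable]
  define \<S> where "\<S> i = {S \<in> [{..<n}]\<^bsup>D\<^esup>. i \<notin> S}" for i
  define star where "star i S = {\<omega> \<in> space M. \<forall>j\<in>S. N (X i \<omega> - X j \<omega>) \<le> r n}" for i S
  define dense where "dense K = {\<omega> \<in> space M. ?k * D \<le> card ([K]\<^bsup>2\<^esup> - ?G \<omega> K) \<and>
    (\<forall>e\<in>[K]\<^bsup>2\<^esup> - ?G \<omega> K. Z n e \<omega>)}" for K
  define B1 where "B1 = (\<Union>i\<in>{..<n}. \<Union>S\<in>\<S> i. star i S)"
  define B2 where "B2 = (\<Union>K\<in>[{..<n}]\<^bsup>?k\<^esup>. dense K)"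
  have fin: "finite ([{..<n}]\<^bsup>j\<^esup>)" for j
    by (rule finite_imp_finite_nsets) simp
  have \<S>_fin: "finite (\<S> i)" for i
    unfolding \<S>_def using fin by simp
  have S: "finite S" "i \<notin> S" "card S = D" if "S \<in> \<S> i" for S i
    using that by (auto simp: \<S>_def nsets_def)
  have K: "K \<subseteq> {..<n}" "finite K" "card K = ?k" if "K \<in> [{..<n}]\<^bsup>?k\<^esup>" for K
    using that by (auto simp: nsets_def)
  have star_events: "star i S \<in> events" if "S \<in> \<S> i" for i S
    unfolding star_def using S(1)[OF that] by measurable
  have dense: "dense K \<in> events" "prob (dense K) \<le> c ^ (?k * D)" if "K \<in> [{..<n}]\<^bsup>?k\<^esup>" for K
    using prob_missing_edges_inserted_le[OF K(1)[OF that] c, of "?k * D" "r n"]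
    unfolding dense_def by blast+
  have union_events: "(\<Union>S\<in>\<S> i. star i S) \<in> events" for i
    using \<S>_fin star_events by auto
  have B_events: "B1 \<in> events" "B2 \<in> events"
    unfolding B1_def B2_def using union_events fin dense by auto
  have "prob B1 \<le> (\<Sum>i\<in>{..<n}. prob (\<Union>S\<in>\<S> i. star i S))"
    unfolding B1_def using union_events by (intro finite_measure_subadditive_finite) auto
  also have "\<dots> \<le> (\<Sum>i\<in>{..<n}. real (n choose D) * b ^ D)"
  proof (rule sum_mono)
    fix i
    have "prob (\<Union>S\<in>\<S> i. star i S) \<le> (\<Sum>S\<in>\<S> i. prob (star i S))"
      using \<S>_fin star_events by (intro finite_measure_subadditive_finite) auto
    also have "\<dots> \<le> (\<Sum>S\<in>\<S> i. b ^ D)"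
      using prob_star_le[OF S(1,2) b ball] S(3) unfolding star_def by (intro sum_mono) fastforce
    also have "\<dots> \<le> real (n choose D) * b ^ D"
      using card_mono[of "[{..<n}]\<^bsup>D\<^esup>" "\<S> i"] fin b
      by (auto simp: \<S>_def card_nsets intro!: mult_right_mono)
    finally show "prob (\<Union>S\<in>\<S> i. star i S) \<le> real (n choose D) * b ^ D" .
  qed
  finally have p1: "prob B1 \<le> ?p1" by simp
  have "prob B2 \<le> (\<Sum>K\<in>[{..<n}]\<^bsup>?k\<^esup>. prob (dense K))"
    unfolding B2_def using fin dense(1) by (intro finite_measure_subadditive_finite) auto
  also have "\<dots> \<le> (\<Sum>K\<in>[{..<n}]\<^bsup>?k\<^esup>. c ^ (?k * D))"
    using dense(2) by (rule sum_mono)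
  finally have p2: "prob B2 \<le> ?p2" by (simp add: card_nsets)
  have "space M - (B1 \<union> B2) \<subseteq> ?T"
  proof
    fix \<omega> assume \<omega>: "\<omega> \<in> space M - (B1 \<union> B2)"
    let ?E = "noisy_edges N r X Z n \<omega>"
    have "edge_clique_number {..<n} ?E u v \<le> 4 * D" if "{u, v} \<in> ?E" for u v
    proof (rule edge_clique_number_le[OF _ noisy_edges_subset that])
      fix K assume sub: "K \<subseteq> {..<n}" and cl: "clique K ?E"
      show "card K \<noteq> Suc (4 * D)"
      proof
        assume card: "card K = Suc (4 * D)"
        have K_fin: "finite K" using sub finite_subset by blast
        then have mem: "K \<in> [{..<n}]\<^bsup>?k\<^esup>"
          using sub card by (simp add: nsets_def)
        have deg: "card {j \<in> K. j \<noteq> i \<and> N (X i \<omega> - X j \<omega>) \<le> r n} \<le> D" if i: "i \<in> K" for i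
        proof (rule ccontr)
          assume "\<not> ?thesis"
          then have "D \<le> card {j \<in> K. j \<noteq> i \<and> N (X i \<omega> - X j \<omega>) \<le> r n}" by simp
          then obtain S' where S': "S' \<subseteq> {j \<in> K. j \<noteq> i \<and> N (X i \<omega> - X j \<omega>) \<le> r n}"
              "card S' = D" "finite S'"
            by (rule obtain_subset_with_card_n)
          have "S' \<subseteq> {..<n}" "i \<notin> S'"
            using S'(1) sub by blast+
          then have "S' \<in> \<S> i"
            using S'(2,3) by (simp add: \<S>_def nsets_def)
          moreover have "\<omega> \<in> star i S'"
            using S'(1) \<omega> unfolding star_def by blast
          ultimately show False
            using \<omega> sub i unfolding B1_def by blast
        qed
        \<comment> \<open>Geometric adjacency depends only on the two points, so a non-edge on
          \<open>K\<close> is a non-edge of the whole geometric graph, and the clique can contain it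
          only as an inserted edge.\<close>
        have "Z n e \<omega>" if e: "e \<in> [K]\<^bsup>2\<^esup> - ?G \<omega> K" for e
        proof -
          obtain i j where ij: "e = {i, j}" "i \<in> K" "j \<in> K" "i \<noteq> j"
            using e by (auto simp: nsets_def card_2_iff)
          then have "e \<in> ?E"
            using cl unfolding clique_def by blast
          moreover have "e \<notin> ?G \<omega> {..<n}"
            using e ij by (auto simp: doubleton_mem_rgg_edges_iff[OF norm])
          ultimately show ?thesis
            by (auto simp: noisy_edges_def insert_edges_def)
        qed
        then have "\<omega> \<in> dense K"
          using card_non_rgg_edges[OF K_fin _ deg] card \<omega> unfolding dense_def by simp
        then show False
          using \<omega> mem unfolding B2_def by blast
      qed
    qed simp
    then show "\<omega> \<in> ?T"
      using \<omega> C unfolding long_edge_def by fastforce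
  qed
  then have "prob (space M - (B1 \<union> B2)) \<le> prob ?T"
    by (intro finite_measure_mono sets_long_edge_clique_number_le)
  moreover have "prob (space M - (B1 \<union> B2)) = 1 - prob (B1 \<union> B2)"
    using B_events by (intro prob_compl) auto
  moreover have "prob (B1 \<union> B2) \<le> prob B1 + prob B2"
    using B_events by (rule measure_Un_le)
  ultimately show ?thesis using p1 p2 by linarith
qed

end

section \<open>Choice of the constants and passage to the limit\<close>

theorem theorem3p17:
  fixes \<beta> :: nat
  shows "\<exists>C>0. \<forall>(M :: 'w measure) (N :: real ^ 'd \<Rightarrow> real) f r q X Z t.
    noisy_rgg M N f r q X Z \<longrightarrow>
    besicovitch_constant N \<beta> \<longrightarrow>
    0 < t \<longrightarrow>
    (\<lambda>n. ess_sup f * real n * r n ^ CARD('d) / ln (real n)) \<longlonglongrightarrow> t \<longrightarrow>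
    (\<forall>n. q n \<le> C) \<longrightarrow>
    (\<exists>C'. whp M (\<lambda>n \<omega>. \<forall>u v.
       long_edge N (r n) (\<lambda>i. X i \<omega>) (noisy_edges N r X Z n \<omega>) u v \<longrightarrow>
       real (edge_clique_number {..<n} (noisy_edges N r X Z n \<omega>) u v)
         \<le> C' * (real n * r n ^ CARD('d))))"
proof (rule exI[of _ "1/2"], intro conjI allI impI)
  fix M :: "'w measure" and N :: "real ^ 'd \<Rightarrow> real" and f r q X Z and t :: real
  assume "noisy_rgg M N f r q X Z" and t: "0 < t"
    and lim: "(\<lambda>n. ess_sup f * real n * r n ^ CARD('d) / ln (real n)) \<longlonglongrightarrow> t"
    and q: "\<forall>n. q n \<le> 1 / 2"
  then interpret noisy_rgg M N f r q X Z by blast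
  let ?V = "\<lambda>n. real n * r n ^ CARD('d)"
  let ?s = "ess_sup f"
  obtain B where B: "B > 0" "\<And>i c \<rho>. 0 < \<rho> \<Longrightarrow>
      emeasure (distr M borel (X i)) {x. N (c - x) \<le> \<rho>} \<le> ennreal (B * \<rho> ^ CARD('d))"
    using prob_ball_le by blast
  have V_pos: "?V n > 0" if "n \<ge> 3" for n
    using that radius_pos by simp
  \<comment> \<open>With \<open>n \<ge> 3\<close> the logarithm is at least 1, which allows clearing
    the denominator and later absorbs the rounding in \<open>D\<close>.\<close>
  have "exp 1 < (3 :: real)"
    using exp_le e_less_272 by simp
  then have ln_ge_1: "ln (real n) \<ge> 1" if "n \<ge> 3" for n
    using that by (subst ln_ge_iff) auto
  have ev: "\<forall>\<^sub>F n in sequentially. t / 2 < ?s * real n * r n ^ CARD('d) / ln (real n) \<and>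
      ?s * real n * r n ^ CARD('d) / ln (real n) < 2 * t \<and> n \<ge> 3"
    using t by (intro eventually_conj order_tendstoD[OF lim] eventually_ge_at_top) auto
  then have ev: "\<forall>\<^sub>F n in sequentially. t / 2 * ln (real n) < ?s * ?V n \<and>
      ?s * ?V n < 2 * t * ln (real n) \<and> n \<ge> 3"
  proof eventually_elim
    case (elim n)
    then show ?case using ln_ge_1[of n] by (simp add: field_simps)
  qed
  \<comment> \<open>A single such \<open>n\<close> shows that the essential supremum is positive:
    its product with the positive \<open>?V n\<close> is positive. Divisions by \<open>?s\<close>
    are then legitimate.\<close>
  then obtain n where n: "t / 2 * ln (real n) < ?s * ?V n" "n \<ge> 3"
    using eventually_happens[OF ev] by auto
  have "0 < t / 2 * ln (real n)"
    using t ln_ge_1[OF n(2)] by (intro mult_pos_pos) auto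
  then have s: "?s > 0"
    using n V_pos[OF n(2)] by (meson less_trans zero_less_mult_pos2)
  \<comment> \<open>Eventually \<open>?V n\<close> is at most \<open>2 * t / ?s * ln n\<close>, so
    the first summand makes \<open>D n\<close> dominate \<open>exp 3 * n * b\<close> for the ball
    bound \<open>b = B * r n ^ CARD('d)\<close>; the summand 4 yields
    \<open>4 * ln n \<le> D n\<close>.\<close>
  define A where "A = exp 3 * (B * (2 * t / ?s)) + 4"
  define D where "D n = nat \<lceil>A * ln (real n)\<rceil>" for n
  \<comment> \<open>Rounding up gives \<open>4 * D n \<le> 4 * (A + 1) * ln n\<close>, and the lower
    half of the limit gives \<open>ln n \<le> 2 * ?s / t * ?V n\<close>.\<close>
  define C' where "C' = 4 * (A + 1) * (2 * ?s / t)"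
  let ?T = "\<lambda>n. prob {\<omega> \<in> space M. \<forall>u v. long_edge N (r n) (\<lambda>i. X i \<omega>) (noisy_edges N r X Z n \<omega>) u v \<longrightarrow>
      real (edge_clique_number {..<n} (noisy_edges N r X Z n \<omega>) u v) \<le> C' * ?V n}"
  have A: "A > 4" "exp 3 * (B * (2 * t / ?s)) \<le> A"
    unfolding A_def using B s t by simp_all
  have lower: "\<forall>\<^sub>F n in sequentially. 1 - 2 / real n \<le> ?T n"
    using ev
  proof eventually_elim
    case (elim n)
    let ?b = "B * r n ^ CARD('d)"
    have ln: "ln (real n) \<ge> 1" using elim ln_ge_1 by blast
    have b: "?b \<ge> 0" using B radius_pos[of n] by simp
    have D_ge: "A * ln (real n) \<le> real (D n)"
      unfolding D_def by linarith
    have "0 \<le> A * ln (real n)" using A ln by simp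
    then have D_le: "real (D n) \<le> A * ln (real n) + 1"
      unfolding D_def by linarith
    have "?V n \<le> 2 * t / ?s * ln (real n)"
      using elim s by (simp add: field_simps)
    then have "exp 3 * B * ?V n \<le> exp 3 * B * (2 * t / ?s * ln (real n))"
      using B by (intro mult_left_mono) auto
    also have "\<dots> = exp 3 * (B * (2 * t / ?s)) * ln (real n)" by simp
    also have "\<dots> \<le> A * ln (real n)"
      using A ln by (intro mult_right_mono) auto
    finally have D1: "exp 3 * (real n * ?b) \<le> real (D n)"
      using D_ge by (simp add: mult_ac)
    have "4 * ln (real n) \<le> A * ln (real n)"
      using A ln by (intro mult_right_mono) auto
    then have D2: "4 * ln (real n) \<le> real (D n)"
      using D_ge by simp
    have "real (4 * D n) \<le> 4 * (A + 1) * ln (real n)"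
      using D_le ln by (simp add: algebra_simps)
    also have "\<dots> \<le> 4 * (A + 1) * (2 * ?s / t * ?V n)"
      using elim t A by (intro mult_left_mono) (auto simp: field_simps)
    finally have C': "real (4 * D n) \<le> C' * ?V n"
      unfolding C'_def by (simp only: mult.assoc)
    have "1 - 2 / real n \<le> 1 - (real n * (real (n choose D n) * ?b ^ D n) +
        real (n choose (4 * D n + 1)) * (1 / 2) ^ ((4 * D n + 1) * D n))"
      using clique_union_bound[OF _ b D1 D2] elim by simp
    also have "\<dots> \<le> ?T n"
      using prob_long_edge_clique_number_ge[OF b B(2)[OF radius_pos] _ _ C', of "1 / 2"] q by simp
    finally show ?case .
  qed
  have "?T \<longlonglongrightarrow> 1"
  proof (rule tendsto_sandwich[OF lower])
    show "(\<lambda>n. 1 - 2 / real n) \<longlonglongrightarrow> 1"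
      using tendsto_diff[OF tendsto_const lim_const_over_n[of 2]] by simp
  qed auto
  then show "\<exists>C'. whp M (\<lambda>n \<omega>. \<forall>u v.
       long_edge N (r n) (\<lambda>i. X i \<omega>) (noisy_edges N r X Z n \<omega>) u v \<longrightarrow>
       real (edge_clique_number {..<n} (noisy_edges N r X Z n \<omega>) u v)
         \<le> C' * (real n * r n ^ CARD('d)))"
    unfolding whp_def by blast
qed simp

end
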